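(* For every $n\in\mathbb{N}$, $$(-1)^{n+1}[2]_q^{2n+2}xyy(xxyy)^nx=(q-q^{-1})^{-1}\sum_{k=0}^{2n+2}(-1)^k[\tilde{G}_{2n+2-k},G_k]_q,$$ $$(-1)^{n+1}[2]_q^{2n+2}yxx(yyxx)^ny=(q-q^{-1})^{-1}\sum_{k=0}^{2n+2}(-1)^k[G_k,\tilde{G}_{2n+2-k}]_q,$$ $$\sum_{k=0}^{2n+1}(-1)^kW_{k+1}\star W_{k-2n-1}=(q^2-1)^{-1}\sum_{k=0}^{2n+2}(-1)^k[G_k,\tilde{G}_{2n+2-k}]=\sum_{k=0}^{2n+1}(-1)^kW_{k-2n-1}\star W_{k+1}.$$
   Context: Let $\mathbb{F}$ be a field of characteristic zero and let $q\in\mathbb{F}$ be nonzero and not a root of unity; $\mathbb{N}=\{0,1,2,\ldots\}$; $[2]_q=q+q^{-1}$. Let $\mathbb{V}$ be the free associative unital $\mathbb{F}$-algebra on two noncommuting generators (letters) $x,y$; the words in $x,y$ (including the trivial word $\mathbf{1}$) form a basis of $\mathbb{V}$. Words such as $(xxyy)^nx$ are written with respect to the free (concatenation) product. The $q$-shuffle product $\star$ on the vector space $\mathbb{V}$ is the bilinear associative product with unit $\mathbf{1}$ determined as follows. Put $\langle x,x\rangle=\langle y,y\rangle=2$ and $\langle x,y\rangle=\langle y,x\rangle=-2$. For nontrivial words $u=u_1\cdots u_r$ and $v=v_1\cdots v_s$, $$u\star v=u_1\big((u_2\cdots u_r)\star v\big)+v_1\big(u\star(v_2\cdots v_s)\big)q^{\langle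 v_1,u_1\rangle+\cdots+\langle v_1,u_r\rangle}.$$ The alternating words are, for $n\in\mathbb{N}$ (powers in the free product): $\tilde{G}_{n+1}=(xy)^{n+1}$, $G_{n+1}=(yx)^{n+1}$, $W_{-n}=(xy)^nx$, $W_{n+1}=(yx)^ny$; also $G_0=\tilde{G}_0=\mathbf{1}$. Commutators are taken with respect to $\star$: $[X,Y]=X\star Y-Y\star X$ and $[X,Y]_q=qX\star Y-q^{-1}Y\star X$. *)

theory Defs
  imports Complex_Main "HOL-Library.Poly_Mapping"
begin

datatype letter = Lx | Ly

instantiation list :: (type) monoid_add
begin
definition zero_list :: "'a list" where "zero_list = []"
definition plus_list :: "'a list \<Rightarrow> 'a list \<Rightarrow> 'a list" where "plus_list u v = u @ v"
instance by standard (simp_all add: zero_list_def plus_list_def)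
end

text \<open>The free associative unital algebra on two letters is the monoid algebra of the free monoid
  of words. Words are added by concatenation, so the convolution product \<open>*\<close> that
  \<open>Poly_Mapping\<close> provides is the free product and \<open>1\<close> is the trivial word.\<close>

type_synonym 'a free_alg = "letter list \<Rightarrow>\<^sub>0 'a"

definition letter :: "letter \<Rightarrow> 'a::field free_alg" where
  "letter a = Poly_Mapping.single [a] 1"

abbreviation xx :: "'a::field free_alg" (\<open>\<^bold>x\<close>) where "\<^bold>x \<equiv> letter Lx"
abbreviation yy :: "'a::field free_alg" (\<open>\<^bold>y\<close>) where "\<^bold>y \<equiv> letter Ly"

definition scale :: "'a::field \<Rightarrow> 'a free_alg \<Rightarrow> 'a free_alg" (infixr \<open>\<cdot>\<close> 75) where
  "c \<cdot> f = Poly_Mapping.map (\<lambda>a. c * a) f"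

lemma lookup_scale: "Poly_Mapping.lookup (c \<cdot> f) w = c * Poly_Mapping.lookup f w"
  unfolding scale_def by (simp add: Poly_Mapping.map.rep_eq when_def)

fun pairing :: "letter \<Rightarrow> letter \<Rightarrow> int" where
  "pairing a b = (if a = b then 2 else -2)"

fun word_shuffle :: "'a::field \<Rightarrow> letter list \<Rightarrow> letter list \<Rightarrow> 'a free_alg" where
  "word_shuffle q [] v = Poly_Mapping.single v 1"
| "word_shuffle q (a # u) [] = Poly_Mapping.single (a # u) 1"
| "word_shuffle q (a # u) (b # v) =
     letter a * word_shuffle q u (b # v)
     + (q powi (\<Sum>c\<leftarrow>a # u. pairing b c)) \<cdot> (letter b * word_shuffle q (a # u) v)"

definition q_shuffle :: "'a::field free_alg \<Rightarrow> 'a \<Rightarrow> 'a free_alg \<Rightarrow> 'a free_alg"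
    (\<open>(_ \<star>\<^bsub>_\<^esub> _)\<close> [71, 0, 71] 70) where
  "f \<star>\<^bsub>q\<^esub> g = (\<Sum>u\<in>Poly_Mapping.keys f. \<Sum>v\<in>Poly_Mapping.keys g.
     (Poly_Mapping.lookup f u * Poly_Mapping.lookup g v) \<cdot> word_shuffle q u v)"

lemma word_mult:
  "Poly_Mapping.single u (1::'a::field) * Poly_Mapping.single v 1 = Poly_Mapping.single (u @ v) 1"
  by (simp add: mult_single plus_list_def)

lemma q_shuffle_words:
  "Poly_Mapping.single u 1 \<star>\<^bsub>q\<^esub> Poly_Mapping.single v 1 = word_shuffle q u v"
  by (simp add: q_shuffle_def poly_mapping_eq_iff fun_eq_iff lookup_scale)

definition comm :: "'a::field \<Rightarrow> 'a free_alg \<Rightarrow> 'a free_alg \<Rightarrow> 'a free_alg" where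
  "comm q f g = f \<star>\<^bsub>q\<^esub> g - g \<star>\<^bsub>q\<^esub> f"

definition q_comm :: "'a::field \<Rightarrow> 'a free_alg \<Rightarrow> 'a free_alg \<Rightarrow> 'a free_alg" where
  "q_comm q f g = q \<cdot> (f \<star>\<^bsub>q\<^esub> g) - inverse q \<cdot> (g \<star>\<^bsub>q\<^esub> f)"

definition q_two :: "'a::field \<Rightarrow> 'a" where
  "q_two q = q + inverse q"

definition G :: "nat \<Rightarrow> 'a::field free_alg" where
  "G n = (\<^bold>y * \<^bold>x) ^ n"

definition Gtilde :: "nat \<Rightarrow> 'a::field free_alg" where
  "Gtilde n = (\<^bold>x * \<^bold>y) ^ n"

text \<open>The two families \<open>W\<^sub>-\<^sub>n\<close> and \<open>W\<^sub>n\<^sub>+\<^sub>1\<close> with \<open>n \<ge> 0\<close> form one family indexed by the integers.\<close>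

definition W :: "int \<Rightarrow> 'a::field free_alg" where
  "W i = (if i \<le> 0 then (\<^bold>x * \<^bold>y) ^ nat (- i) * \<^bold>x else (\<^bold>y * \<^bold>x) ^ nat (i - 1) * \<^bold>y)"

lemma W_nonpos: "W (- int n) = (\<^bold>x * \<^bold>y) ^ n * \<^bold>x"
  by (simp add: W_def)

lemma W_pos: "W (int n + 1) = (\<^bold>y * \<^bold>x) ^ n * \<^bold>y"
  by (simp add: W_def)

end

theory Submission
  imports Defs
begin

text \<open>In generating-function form, the sums are coefficients of the products
  \<open>Gtilde(t) \<star> G(-t)\<close>, \<open>W\<^sub>+(t) \<star> G(-t)\<close>, \<open>Gtilde(t) \<star> W\<^sub>-(-t)\<close>, \<open>W\<^sub>+(t) \<star> W\<^sub>-(-t)\<close> and of their images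
  under exchanging the letters. Splitting off first letters gives a closed linear system for these
  four series. Because the two arguments are \<open>t\<close> and \<open>-t\<close>, eliminating the first and the last series
  leaves a two-term recursion whose solution in each degree is a multiple of a single word.\<close>

section \<open>Scalars and the free product\<close>

lemma scale_eq_mult: "c \<cdot> f = Poly_Mapping.single 0 c * f"
  unfolding scale_def by (rule mult_map_scale_conv_mult)

text \<open>Coefficients commute, so scalars are central; both sides are additive in
  \<open>f\<close>, which is built up one monomial at a time.\<close>

lemma mult_single_zero: "f * Poly_Mapping.single 0 c = c \<cdot> (f :: 'a::field free_alg)"
  unfolding scale_eq_mult
proof (induction f rule: update_induct)
  case const
  then show ?case by simp
next
  case (update f w d)
  have "Poly_Mapping.update w d f = f + Poly_Mapping.single w d"
    by (rule poly_mapping_eqI)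
      (use update.hyps in \<open>auto simp: lookup_update lookup_add lookup_single in_keys_iff\<close>)
  with update.IH show ?case by (simp add: mult_single mult.commute distrib_left distrib_right)
qed

lemma scale_mult_left [simp]: "(c \<cdot> f) * g = c \<cdot> (f * g)"
  by (simp add: scale_eq_mult mult.assoc)

lemma scale_mult_right [simp]: "f * (c \<cdot> g) = c \<cdot> (f * g)"
  by (metis mult.assoc mult_single_zero scale_eq_mult)

interpretation scale: vector_space "scale :: 'a::field \<Rightarrow> 'a free_alg \<Rightarrow> 'a free_alg"
  by standard (simp_all add: poly_mapping_eq_iff fun_eq_iff lookup_scale lookup_add algebra_simps)

section \<open>Alternating words as basis elements\<close>

lemma power_mult_shift: "(u * v) ^ n * u = u * (v * u) ^ n" for u :: "'a::monoid_mult"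
  by (induction n) (simp_all add: mult.assoc)

text \<open>Indexing by length covers all four families at once, and deleting the first letter
  merely exchanges \<open>a\<close> and \<open>b\<close>.\<close>

fun alternating :: "letter \<Rightarrow> letter \<Rightarrow> nat \<Rightarrow> letter list" where
  "alternating a b 0 = []"
| "alternating a b (Suc n) = a # alternating b a n"

lemma single_Cons: "Poly_Mapping.single (a # w) (1 :: 'a::field) = letter a * Poly_Mapping.single w 1"
  by (simp add: letter_def word_mult)

lemma single_Nil: "Poly_Mapping.single [] (1 :: 'a::field) = 1"
  by (simp flip: zero_list_def)

lemma single_alternating_even:
  "Poly_Mapping.single (alternating a b (2 * n)) (1 :: 'a::field) = (letter a * letter b) ^ n"
  by (induction n) (simp_all add: single_Cons single_Nil mult.assoc)

lemma single_alternating_odd: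
  "Poly_Mapping.single (alternating a b (Suc (2 * n))) (1 :: 'a::field)
    = (letter a * letter b) ^ n * letter a"
  by (simp add: single_Cons single_alternating_even power_mult_shift)

text \<open>Each block \<open>a b\<close> contributes 2 - 2 = 0. So the power of \<open>q\<close> in
  the shuffle recursion is constant along each family of alternating left factors.\<close>

lemma sum_pairing_alternating_even:
  assumes "a \<noteq> b"
  shows "(\<Sum>c\<leftarrow>alternating a b (2 * n). pairing d c) = 0"
  using assms by (induction n) (cases a; cases b; cases d; simp)+

lemma sum_pairing_alternating_odd:
  assumes "a \<noteq> b"
  shows "(\<Sum>c\<leftarrow>alternating a b (Suc (2 * n)). pairing d c) = pairing d a"
  using sum_pairing_alternating_even[of b a] assms by simp

section \<open>Signed convolutions and splitting off first letters\<close>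

text \<open>The coefficient of t^N in the shuffle product of f(t) with g(-t).\<close>

definition signed_conv ::
  "'a::field \<Rightarrow> (nat \<Rightarrow> letter list) \<Rightarrow> (nat \<Rightarrow> letter list) \<Rightarrow> nat \<Rightarrow> 'a free_alg" where
  "signed_conv q f g N = (\<Sum>k\<le>N. (-1) ^ k \<cdot> word_shuffle q (f (N - k)) (g k))"

lemma word_shuffle_Nil_right: "word_shuffle q u [] = Poly_Mapping.single u 1"
  by (cases u) simp_all

lemma signed_conv_0: "signed_conv q f g 0 = word_shuffle q (f 0) (g 0)"
  by (simp add: signed_conv_def)

context
  fixes q :: "'a::field" and f f' g g' :: "nat \<Rightarrow> letter list" and a b :: letter and e :: int
  assumes wt: "\<And>n. (\<Sum>c\<leftarrow>f n. pairing b c) = e"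
begin

text \<open>By \<open>wt\<close> all summands carry the same power of \<open>q\<close>, which
  therefore factors out of the whole convolution.\<close>

lemma signed_conv_Cons_Cons:
  assumes "\<And>n. f n = a # f' n" and "\<And>n. g n = b # g' n"
  shows "signed_conv q f g N
    = letter a * signed_conv q f' g N + (q powi e) \<cdot> (letter b * signed_conv q f g' N)"
proof -
  have "word_shuffle q (f i) (g j) = letter a * word_shuffle q (f' i) (g j)
    + (q powi e) \<cdot> (letter b * word_shuffle q (f i) (g' j))" for i j
    using wt[of i] assms by (simp del: pairing.simps)
  then show ?thesis
    by (simp add: signed_conv_def scale.scale_right_distrib sum.distrib sum_distrib_left
        scale.scale_sum_right scale.scale_left_commute mult.commute)
qed

text \<open>At \<open>k = Suc N\<close> the left word is empty and the \<open>a\<close> branch is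
  missing, so that convolution drops one degree. The empty word also forces
  \<open>e = 0\<close>.\<close>

lemma signed_conv_Nil_Cons:
  assumes "f 0 = []" "\<And>n. f (Suc n) = a # f' n" and "\<And>n. g n = b # g' n"
  shows "signed_conv q f g (Suc N)
    = letter a * signed_conv q f' g N + letter b * signed_conv q f g' (Suc N)"
proof -
  have "e = 0" using wt[of 0] assms by simp
  then have S: "word_shuffle q (f (Suc i)) (g j) = letter a * word_shuffle q (f' i) (g j)
    + letter b * word_shuffle q (f (Suc i)) (g' j)" for i j
    using wt[of "Suc i"] assms by (simp del: pairing.simps)
  have "word_shuffle q (f 0) (g j) = letter b * word_shuffle q (f 0) (g' j)" for j
    using assms by (simp add: single_Cons)
  with S show ?thesis
    by (simp add: signed_conv_def scale.scale_right_distrib sum.distrib sum_distrib_left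
        Suc_diff_le distrib_left right_diff_distrib cong: sum.cong_simp)
qed

text \<open>At \<open>k = 0\<close> the right word is empty and the \<open>b\<close> branch is
  missing; shifting \<open>k\<close> in the other \<open>b\<close> terms lowers the degree and flips
  the sign.\<close>

lemma signed_conv_Cons_Nil:
  assumes "\<And>n. f n = a # f' n" and "g 0 = []" "\<And>n. g (Suc n) = b # g' n"
  shows "signed_conv q f g (Suc N)
    = letter a * signed_conv q f' g (Suc N) - (q powi e) \<cdot> (letter b * signed_conv q f g' N)"
proof -
  have S: "word_shuffle q (f i) (g (Suc j)) = letter a * word_shuffle q (f' i) (g (Suc j))
    + (q powi e) \<cdot> (letter b * word_shuffle q (f i) (g' j))" for i j
    using wt[of i] assms by (simp del: pairing.simps)
  have "word_shuffle q (f i) (g 0) = letter a * word_shuffle q (f' i) (g 0)" for i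
    using assms by (simp add: word_shuffle_Nil_right single_Cons)
  with S show ?thesis
    unfolding signed_conv_def sum.atMost_Suc_shift
    by (simp add: scale.scale_right_distrib sum.distrib sum_distrib_left sum_negf sum_subtractf
        scale.scale_sum_right scale.scale_left_commute mult.commute right_diff_distrib distrib_left)
qed

lemma signed_conv_Nil_Nil:
  assumes "f 0 = []" "\<And>n. f (Suc n) = a # f' n" and "g 0 = []" "\<And>n. g (Suc n) = b # g' n"
  shows "signed_conv q f g (Suc N) = letter a * signed_conv q f' g N - letter b * signed_conv q f g' N"
proof -
  have "e = 0" using wt[of 0] assms by simp
  then have S: "word_shuffle q (f (Suc i)) (g (Suc j)) = letter a * word_shuffle q (f' i) (g (Suc j))
    + letter b * word_shuffle q (f (Suc i)) (g' j)" for i j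
    using wt[of "Suc i"] assms by (simp del: pairing.simps)
  have f0: "word_shuffle q (f 0) (g (Suc j)) = letter b * word_shuffle q (f 0) (g' j)" for j
    using assms by (simp add: single_Cons)
  have g0: "word_shuffle q (f (Suc i)) (g 0) = letter a * word_shuffle q (f' i) (g 0)" for i
    using assms by (simp add: word_shuffle_Nil_right single_Cons)
  show ?thesis
  \<comment> \<open>Each end term has only one branch and is peeled off; for \<open>N = 0\<close>
    there are no interior terms.\<close>
  proof (cases N)
    case 0
    then show ?thesis by (simp add: signed_conv_def f0 g0)
  next
    case (Suc M)
    have "signed_conv q f g (Suc (Suc M)) =
      word_shuffle q (f (Suc (Suc M))) (g 0)
      + (\<Sum>k\<le>M. (-1) ^ Suc k \<cdot> word_shuffle q (f (Suc (M - k))) (g (Suc k)))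
      + (-1) ^ Suc (Suc M) \<cdot> word_shuffle q (f 0) (g (Suc (Suc M)))"
      unfolding signed_conv_def
      by (subst sum.atMost_Suc, subst sum.atMost_Suc_shift) (simp add: Suc_diff_le cong: sum.cong_simp)
    also have "\<dots> = letter a * (word_shuffle q (f' (Suc M)) (g 0)
        + (\<Sum>k\<le>M. (-1) ^ Suc k \<cdot> word_shuffle q (f' (M - k)) (g (Suc k))))
      - letter b * ((\<Sum>k\<le>M. (-1) ^ k \<cdot> word_shuffle q (f (Suc M - k)) (g' k))
        + (-1) ^ Suc M \<cdot> word_shuffle q (f 0) (g' (Suc M)))"
      by (simp add: S f0 g0 scale.scale_right_distrib sum.distrib sum_distrib_left sum_negf sum_subtractf
          Suc_diff_le distrib_left right_diff_distrib cong: sum.cong_simp)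
    also have "word_shuffle q (f' (Suc M)) (g 0)
        + (\<Sum>k\<le>M. (-1) ^ Suc k \<cdot> word_shuffle q (f' (M - k)) (g (Suc k)))
      = signed_conv q f' g (Suc M)"
      unfolding signed_conv_def by (subst sum.atMost_Suc_shift) simp
    also have "(\<Sum>k\<le>M. (-1) ^ k \<cdot> word_shuffle q (f (Suc M - k)) (g' k))
        + (-1) ^ Suc M \<cdot> word_shuffle q (f 0) (g' (Suc M))
      = signed_conv q f g' (Suc M)"
      by (simp add: signed_conv_def)
    finally show ?thesis using Suc by simp
  qed
qed

end

section \<open>The linear system and its solution\<close>

text \<open>The word of the first two identities with the scalar collected in \<open>n\<close>
  rounds of the recursion; the missing factor -[2]_q^2 comes from the final commutator.\<close>

definition core :: "'a::field \<Rightarrow> nat \<Rightarrow> letter \<Rightarrow> letter \<Rightarrow> 'a free_alg" where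
  "core q n c d = ((-1) ^ n * q_two q ^ (2 * n)) \<cdot>
     (letter c * letter d * letter d * (letter c * letter c * letter d * letter d) ^ n * letter c)"

context
  fixes q :: "'a::field" and a b :: letter
  assumes ab: "a \<noteq> b" and q0: "q \<noteq> 0"
begin

abbreviation (input) "ev c d \<equiv> (\<lambda>n. alternating c d (2 * n))"
abbreviation (input) "od c d \<equiv> (\<lambda>n. alternating c d (Suc (2 * n)))"

text \<open>For \<open>a = Lx\<close>, \<open>b = Ly\<close> these are the four products Gtilde G,
  W_+ G, Gtilde W_- and W_+ W_-. Keeping the letters abstract yields the mirrored products by
  exchanging them.\<close>

abbreviation "conv_A \<equiv> signed_conv q (ev a b) (ev b a)"
abbreviation "conv_P \<equiv> signed_conv q (od b a) (ev b a)"
abbreviation "conv_Q \<equiv> signed_conv q (ev a b) (od a b)"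
abbreviation "conv_R \<equiv> signed_conv q (od b a) (od a b)"

lemma conv_A_Suc: "conv_A (Suc N) = letter a * conv_P N - letter b * conv_Q N"
  by (rule signed_conv_Nil_Nil[OF sum_pairing_alternating_even[OF ab]]) simp_all

text \<open>Both nonempty words start with \<open>b\<close>, and the odd left word has weight 2
  against \<open>b\<close>; hence the factor q^2.\<close>

lemma conv_P_Suc: "conv_P (Suc N) = letter b * conv_A (Suc N) - q\<^sup>2 \<cdot> (letter b * conv_R N)"
  using signed_conv_Cons_Nil[where q = q and a = b and b = b and N = N
      and f = "od b a" and g = "ev b a" and f' = "ev a b" and g' = "od a b",
      OF sum_pairing_alternating_odd[OF ab[symmetric]]]
  by simp

lemma conv_Q_Suc: "conv_Q (Suc N) = letter a * conv_R N + letter a * conv_A (Suc N)"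
  by (rule signed_conv_Nil_Cons[OF sum_pairing_alternating_even[OF ab]]) simp_all

lemma conv_R: "conv_R N = letter b * conv_Q N + inverse (q\<^sup>2) \<cdot> (letter a * conv_P N)"
proof -
  have "q powi pairing a b = inverse (q\<^sup>2)" using ab by (simp add: power_int_def power_inverse)
  then show ?thesis
    using signed_conv_Cons_Cons[where q = q and a = b and b = a and N = N
      and f = "od b a" and g = "od a b" and f' = "ev a b" and g' = "ev b a",
        OF sum_pairing_alternating_odd[OF ab[symmetric]]]
    by simp
qed

text \<open>Substituting for \<open>conv_A\<close> and \<open>conv_R\<close>, the
  \<open>b a P\<close> terms cancel because q^2 meets q^(-2); the two \<open>b b Q\<close> terms add
  up.\<close>

lemma conv_P_rec: "conv_P (Suc N) = - (1 + q\<^sup>2) \<cdot> (letter b * letter b * conv_Q N)"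
  by (simp add: conv_P_Suc conv_A_Suc conv_R mult.assoc distrib_left right_diff_distrib
      scale.scale_right_distrib scale.scale_left_distrib scale.scale_left_diff_distrib q0
      del: alternating.simps)

text \<open>Here the \<open>a b Q\<close> terms have opposite signs and cancel, leaving only
  \<open>a a P\<close>.\<close>

lemma conv_Q_rec: "conv_Q (Suc N) = (1 + inverse (q\<^sup>2)) \<cdot> (letter a * letter a * conv_P N)"
  by (simp add: conv_Q_Suc conv_A_Suc conv_R mult.assoc distrib_left right_diff_distrib
      scale.scale_right_distrib scale.scale_left_distrib del: alternating.simps)

lemma q_two_power2: "q_two q ^ 2 = (1 + q\<^sup>2) * (1 + inverse (q\<^sup>2))"
  using q0 by (simp add: q_two_def field_simps power2_eq_square)

text \<open>Two steps of the recursion prepend \<open>b b a a\<close> and multiply by -(1 + q^2)(1 +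
  q^(-2)) = -[2]_q^2.\<close>

lemma conv_P_even: "conv_P (2 * n) =
  ((-1) ^ n * q_two q ^ (2 * n)) \<cdot> ((letter b * letter b * letter a * letter a) ^ n * letter b)"
proof (induction n)
  case 0
  then show ?case by (simp add: signed_conv_0 single_Cons single_Nil)
next
  case (Suc n)
  have "conv_P (2 * Suc n) = (- (q_two q ^ 2)) \<cdot>
      (letter b * letter b * letter a * letter a * conv_P (2 * n))"
    by (simp only: mult_Suc_right add_2_eq_Suc conv_P_rec conv_Q_rec scale_mult_right
        scale.scale_scale q_two_power2 mult.assoc mult_minus_left)
  then show ?case
    unfolding Suc.IH by (simp add: power2_eq_square mult_ac mult.assoc)
qed

lemma conv_Q_even: "conv_Q (2 * n) =
  ((-1) ^ n * q_two q ^ (2 * n)) \<cdot> ((letter a * letter a * letter b * letter b) ^ n * letter a)"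
proof (induction n)
  case 0
  then show ?case by (simp add: signed_conv_0 single_Cons single_Nil)
next
  case (Suc n)
  have "conv_Q (2 * Suc n) = (- (q_two q ^ 2)) \<cdot>
      (letter a * letter a * letter b * letter b * conv_Q (2 * n))"
    by (simp only: mult_Suc_right add_2_eq_Suc conv_P_rec conv_Q_rec scale_mult_right
        scale.scale_scale q_two_power2 mult.assoc mult_minus_right mult.commute[of "1 + q\<^sup>2"])
  then show ?case
    unfolding Suc.IH by (simp add: power2_eq_square mult_ac mult.assoc)
qed

lemma letter_conv_P_odd: "letter a * conv_P (Suc (2 * n)) = - (1 + q\<^sup>2) \<cdot> core q n a b"
  unfolding conv_P_rec conv_Q_even core_def by (simp add: mult.assoc mult_ac)

lemma letter_conv_Q_odd: "letter b * conv_Q (Suc (2 * n)) = (1 + inverse (q\<^sup>2)) \<cdot> core q n b a"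
  unfolding conv_Q_rec conv_P_even core_def by (simp add: mult.assoc mult_ac)

lemma conv_A_even: "conv_A (2 * n + 2) =
  - (1 + q\<^sup>2) \<cdot> core q n a b - (1 + inverse (q\<^sup>2)) \<cdot> core q n b a"
  using conv_A_Suc[of "Suc (2 * n)"]
  by (simp only: letter_conv_P_odd letter_conv_Q_odd add_2_eq_Suc')

text \<open>The factor q^(-2) in \<open>conv_R\<close> turns -(1 + q^2) into -(1 + q^(-2)), so both
  words share one coefficient up to sign.\<close>

lemma conv_R_odd: "conv_R (2 * n + 1) = (1 + inverse (q\<^sup>2)) \<cdot> (core q n b a - core q n a b)"
proof -
  have "inverse (q\<^sup>2) * (- (1 + q\<^sup>2)) = - (1 + inverse (q\<^sup>2))"
    using q0 by (simp add: field_simps)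
  then show ?thesis
    unfolding Suc_eq_plus1[symmetric] conv_R letter_conv_P_odd letter_conv_Q_odd scale.scale_scale
    by (simp only: scale.scale_right_diff_distrib scale.scale_minus_left add_uminus_conv_diff)
qed

end

section \<open>The sums of the statement as signed convolutions\<close>

lemma Gtilde_eq: "Gtilde n = Poly_Mapping.single (alternating Lx Ly (2 * n)) 1"
  by (simp add: Gtilde_def single_alternating_even)

lemma G_eq: "G n = Poly_Mapping.single (alternating Ly Lx (2 * n)) 1"
  by (simp add: G_def single_alternating_even)

lemma W_nonpos_eq:
  assumes "k \<le> N"
  shows "W (int k - int N) = Poly_Mapping.single (alternating Lx Ly (Suc (2 * (N - k)))) 1"
  using W_nonpos[of "N - k"] assms by (simp only: single_alternating_odd) (simp add: of_nat_diff)

lemma W_pos_eq: "W (int k + 1) = Poly_Mapping.single (alternating Ly Lx (Suc (2 * k))) 1"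
  by (simp only: W_pos single_alternating_odd)

text \<open>Reversing the sum handles products whose left index is \<open>k\<close>; the sign
  (-1)^(N - k) equals (-1)^N (-1)^k.\<close>

lemma signed_conv_rev:
  "(\<Sum>k\<le>N. (-1) ^ k \<cdot> word_shuffle q (f k) (g (N - k))) = (-1) ^ N \<cdot> signed_conv q f g N"
proof -
  have "(\<Sum>k\<le>N. (-1) ^ k \<cdot> word_shuffle q (f k) (g (N - k)))
    = (\<Sum>k\<le>N. (-1) ^ (N - k) \<cdot> word_shuffle q (f (N - k)) (g k))"
    unfolding atLeast0AtMost[symmetric] by (subst sum.atLeastAtMost_rev) simp
  also have "\<dots> = (-1) ^ N \<cdot> signed_conv q f g N"
    unfolding signed_conv_def scale.scale_sum_right
    by (rule sum.cong) (auto simp: minus_one_power_iff)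
  finally show ?thesis .
qed

lemma sum_Gtilde_G:
  "(\<Sum>k=0..N. (-1) ^ k \<cdot> (Gtilde (N - k) \<star>\<^bsub>q\<^esub> G k))
    = signed_conv q (\<lambda>n. alternating Lx Ly (2 * n)) (\<lambda>n. alternating Ly Lx (2 * n)) N"
  by (simp add: signed_conv_def Gtilde_eq G_eq q_shuffle_words atLeast0AtMost)

lemma sum_G_Gtilde:
  assumes "even N"
  shows "(\<Sum>k=0..N. (-1) ^ k \<cdot> (G k \<star>\<^bsub>q\<^esub> Gtilde (N - k)))
    = signed_conv q (\<lambda>n. alternating Ly Lx (2 * n)) (\<lambda>n. alternating Lx Ly (2 * n)) N"
  using assms signed_conv_rev[of q "\<lambda>n. alternating Ly Lx (2 * n)" "\<lambda>n. alternating Lx Ly (2 * n)" N]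
  by (simp add: Gtilde_eq G_eq q_shuffle_words atLeast0AtMost)

lemma sum_W_pos_nonpos:
  "(\<Sum>k=0..N. (-1) ^ k \<cdot> (W (int k + 1) \<star>\<^bsub>q\<^esub> W (int k - int N)))
    = (-1) ^ N \<cdot> signed_conv q (\<lambda>n. alternating Ly Lx (Suc (2 * n))) (\<lambda>n. alternating Lx Ly (Suc (2 * n))) N"
  unfolding signed_conv_rev[symmetric] atLeast0AtMost
  by (rule sum.cong) (simp_all only: W_pos_eq W_nonpos_eq q_shuffle_words atMost_iff)

lemma sum_W_nonpos_pos:
  "(\<Sum>k=0..N. (-1) ^ k \<cdot> (W (int k - int N) \<star>\<^bsub>q\<^esub> W (int k + 1)))
    = signed_conv q (\<lambda>n. alternating Lx Ly (Suc (2 * n))) (\<lambda>n. alternating Ly Lx (Suc (2 * n))) N"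
  unfolding signed_conv_def atLeast0AtMost
  by (rule sum.cong) (simp_all only: W_pos_eq W_nonpos_eq q_shuffle_words atMost_iff)

theorem corollary5p12:
  fixes q :: "'a::field_char_0" and n :: nat
  assumes "q \<noteq> 0"
    and "\<And>m::nat. m > 0 \<Longrightarrow> q ^ m \<noteq> 1"
  shows "(((-1) ^ (n + 1) * q_two q ^ (2 * n + 2)) \<cdot>
           (\<^bold>x * \<^bold>y * \<^bold>y * (\<^bold>x * \<^bold>x * \<^bold>y * \<^bold>y) ^ n * \<^bold>x)
         = inverse (q - inverse q) \<cdot>
           (\<Sum>k = 0..2 * n + 2. (-1) ^ k \<cdot> q_comm q (Gtilde (2 * n + 2 - k)) (G k)))
    \<and> (((-1) ^ (n + 1) * q_two q ^ (2 * n + 2)) \<cdot>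
           (\<^bold>y * \<^bold>x * \<^bold>x * (\<^bold>y * \<^bold>y * \<^bold>x * \<^bold>x) ^ n * \<^bold>y)
         = inverse (q - inverse q) \<cdot>
           (\<Sum>k = 0..2 * n + 2. (-1) ^ k \<cdot> q_comm q (G k) (Gtilde (2 * n + 2 - k))))
    \<and> ((\<Sum>k = 0..2 * n + 1. (-1) ^ k \<cdot> (W (int k + 1) \<star>\<^bsub>q\<^esub> W (int k - 2 * int n - 1)))
         = inverse (q\<^sup>2 - 1) \<cdot>
           (\<Sum>k = 0..2 * n + 2. (-1) ^ k \<cdot> comm q (G k) (Gtilde (2 * n + 2 - k))))
    \<and> (inverse (q\<^sup>2 - 1) \<cdot>
           (\<Sum>k = 0..2 * n + 2. (-1) ^ k \<cdot> comm q (G k) (Gtilde (2 * n + 2 - k)))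
         = (\<Sum>k = 0..2 * n + 1. (-1) ^ k \<cdot> (W (int k - 2 * int n - 1) \<star>\<^bsub>q\<^esub> W (int k + 1))))"
proof -
  \<comment> \<open>The exponent \<open>m = 2\<close> makes both q - q^(-1) and q^2 - 1
    invertible.\<close>
  have q0: "q \<noteq> 0" and q2: "q\<^sup>2 \<noteq> 1" using assms by simp_all
  have qi: "q - inverse q \<noteq> 0" using q0 q2 by (simp add: field_simps power2_eq_square)
  let ?A = "signed_conv q (\<lambda>n. alternating Lx Ly (2 * n)) (\<lambda>n. alternating Ly Lx (2 * n)) (2 * n + 2)"
  let ?B = "signed_conv q (\<lambda>n. alternating Ly Lx (2 * n)) (\<lambda>n. alternating Lx Ly (2 * n)) (2 * n + 2)"
  let ?U = "core q n Lx Ly" and ?V = "core q n Ly Lx"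
  have A: "?A = - (1 + q\<^sup>2) \<cdot> ?U - (1 + inverse (q\<^sup>2)) \<cdot> ?V"
    by (rule conv_A_even) (simp_all add: q0)
  \<comment> \<open>This is the instance of \<open>conv_A\<close> with the two letters
    exchanged.\<close>
  have B: "?B = - (1 + q\<^sup>2) \<cdot> ?V - (1 + inverse (q\<^sup>2)) \<cdot> ?U"
    by (rule conv_A_even) (simp_all add: q0)
  \<comment> \<open>Naming the inverse turns the coefficient identities into polynomial identities
    modulo \<open>q * r = 1\<close>.\<close>
  define r where "r = inverse q"
  have qr: "q * r = 1" and r2: "inverse (q\<^sup>2) = r\<^sup>2"
    using q0 by (simp_all add: r_def power_inverse)
  have "inverse (q - r) * (q * (- (1 + q\<^sup>2) * u - (1 + r\<^sup>2) * v)
      - r * (- (1 + q\<^sup>2) * v - (1 + r\<^sup>2) * u)) = - ((q + r) ^ 2) * u" for u v :: 'a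
  proof -
    have "q * (- (1 + q\<^sup>2) * u - (1 + r\<^sup>2) * v) - r * (- (1 + q\<^sup>2) * v - (1 + r\<^sup>2) * u)
        = (q - r) * (- ((q + r) ^ 2) * u)"
      using qr by algebra
    then show ?thesis using qi by (simp add: r_def)
  qed
  \<comment> \<open>Only scalars act on \<open>u\<close> and \<open>v\<close>, so the field identity
    lifts coefficientwise. The \<open>v\<close> terms cancel, which leaves a single word.\<close>
  then have qc: "inverse (q - inverse q) \<cdot>
      (q \<cdot> (- (1 + q\<^sup>2) \<cdot> u - (1 + inverse (q\<^sup>2)) \<cdot> v)
        - inverse q \<cdot> (- (1 + q\<^sup>2) \<cdot> v - (1 + inverse (q\<^sup>2)) \<cdot> u))
    = (- (q_two q ^ 2)) \<cdot> u" for u v :: "'a free_alg"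
    by (intro poly_mapping_eqI) (simp only: lookup_scale lookup_minus r2 q_two_def flip: r_def)
  have "inverse (q\<^sup>2 - 1) * ((- (1 + q\<^sup>2) * v - (1 + r\<^sup>2) * u) - (- (1 + q\<^sup>2) * u - (1 + r\<^sup>2) * v))
      = (1 + r\<^sup>2) * (u - v)" for u v :: 'a
  proof -
    have "(- (1 + q\<^sup>2) * v - (1 + r\<^sup>2) * u) - (- (1 + q\<^sup>2) * u - (1 + r\<^sup>2) * v)
        = (q\<^sup>2 - 1) * ((1 + r\<^sup>2) * (u - v))"
      using qr by algebra
    then show ?thesis using q2 by simp
  qed
  then have cc: "inverse (q\<^sup>2 - 1) \<cdot> (?B - ?A) = (1 + inverse (q\<^sup>2)) \<cdot> (?U - ?V)"
    unfolding A B by (intro poly_mapping_eqI) (simp only: lookup_scale lookup_minus r2)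
  have core: "((-1) ^ (n + 1) * q_two q ^ (2 * n + 2)) \<cdot>
      (letter a * letter b * letter b * (letter a * letter a * letter b * letter b) ^ n * letter a)
    = (- (q_two q ^ 2)) \<cdot> core q n a b" for a b
    by (simp add: core_def power_add mult_ac power2_eq_square)
  have even_2n2: "even (2 * n + 2)" by simp
  have 1: "(\<Sum>k = 0..2 * n + 2. (-1) ^ k \<cdot> q_comm q (Gtilde (2 * n + 2 - k)) (G k))
    = q \<cdot> ?A - inverse q \<cdot> ?B"
    by (simp only: sum_Gtilde_G[symmetric] sum_G_Gtilde[symmetric] even_2n2 q_comm_def
        scale.scale_right_diff_distrib scale.scale_sum_right sum_subtractf scale.scale_left_commute)
  have 2: "(\<Sum>k = 0..2 * n + 2. (-1) ^ k \<cdot> q_comm q (G k) (Gtilde (2 * n + 2 - k)))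
    = q \<cdot> ?B - inverse q \<cdot> ?A"
    by (simp only: sum_Gtilde_G[symmetric] sum_G_Gtilde[symmetric] even_2n2 q_comm_def
        scale.scale_right_diff_distrib scale.scale_sum_right sum_subtractf scale.scale_left_commute)
  have 3: "(\<Sum>k = 0..2 * n + 2. (-1) ^ k \<cdot> comm q (G k) (Gtilde (2 * n + 2 - k))) = ?B - ?A"
    by (simp only: sum_Gtilde_G[symmetric] sum_G_Gtilde[symmetric] even_2n2 comm_def
        scale.scale_right_diff_distrib sum_subtractf)
  have index: "int k - int (2 * n + 1) = int k - 2 * int n - 1" for k by simp
  \<comment> \<open>The reversal sign is -1 since 2n + 1 is odd. It turns \<open>?V - ?U\<close>
    into \<open>?U - ?V\<close>, the value that \<open>W2\<close> gets by exchanging the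
    letters.\<close>
  have W1: "(\<Sum>k = 0..2 * n + 1. (-1) ^ k \<cdot> (W (int k + 1) \<star>\<^bsub>q\<^esub> W (int k - 2 * int n - 1)))
    = (1 + inverse (q\<^sup>2)) \<cdot> (?U - ?V)"
    unfolding sum_W_pos_nonpos[where N = "2 * n + 1" and q = q, unfolded index]
    by (subst conv_R_odd) (simp_all add: q0 scale.scale_right_diff_distrib scale.scale_left_diff_distrib
        scale.scale_left_distrib)
  have W2: "(\<Sum>k = 0..2 * n + 1. (-1) ^ k \<cdot> (W (int k - 2 * int n - 1) \<star>\<^bsub>q\<^esub> W (int k + 1)))
    = (1 + inverse (q\<^sup>2)) \<cdot> (?U - ?V)"
    unfolding sum_W_nonpos_pos[where N = "2 * n + 1" and q = q, unfolded index]
    by (rule conv_R_odd) (simp_all add: q0)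
  show ?thesis
    unfolding 1 2 3 W1 W2 core cc unfolding A B qc by simp
qed

end
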